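(* Let $k \in \mathbb{N}$ with $k \geq 2$. Then there exists a covering cycle $\mathcal{P}(h(2,k))$ for $H(2,k) = \{0,1\}^k \subset \mathbb{R}^k$ of link-length $h(2,k) = 3 \cdot 2^{k-2}$, where $h(2,k)$ is the minimum link-length of a polygonal chain in $\mathbb{R}^k$ visiting all the points of $H(2,k)$.
   Context: A polygonal chain with $m$ links (i.e. of link-length $m$) in $\mathbb{R}^k$ is given by a sequence of $m+1$ vertices $S_1, S_2, \dots, S_{m+1} \in \mathbb{R}^k$ (arbitrary points, not necessarily in $\{0,1\}^k$ or in $[0,1]^k$); its links are the closed line segments $\overline{S_1S_2}, \overline{S_2S_3}, \dots, \overline{S_mS_{m+1}}$, and as a point set it is $\mathcal{P}(m) = \overline{S_1S_2} \cup \overline{S_2S_3} \cup \dots \cup \overline{S_mS_{m+1}}$. Self-intersections are allowed. The chain visits (covers) a point set $X$ if $X \subset \mathcal{P}(m)$. $H(2,k) = \{0,1\}^k \subset \mathbb{R}^k$ is the set of the $2^k$ nodes of the hypercube $[0,1]^k$. $h(2,k)$ is the smallest $m$ for which there is a polygonal chain with $m$ links covering $H(2,k)$. A polygonal chain covering $H(2,k)$ is a (covering) path if no element of $H(2,k)$ belongs to more than one link of the chain (the path may be self-intersecting elsewhere). A covering cycle is a covering path that is closed, i.e. $S_1 = S_{m+1}$. *)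

theory Defs
  imports "HOL-Analysis.Analysis"
begin

text \<open>
  A polygonal chain is the list of its vertices: \<open>m\<close> links means \<open>m + 1\<close> vertices.
  Vertices are arbitrary points; consecutive ones may coincide.
  Links are indexed from 0, so link \<open>i\<close> joins the vertices at positions \<open>i\<close> and \<open>i + 1\<close>.
\<close>

definition polygonal_chain :: "nat \<Rightarrow> 'a::real_vector list \<Rightarrow> bool" where
  "polygonal_chain m S \<longleftrightarrow> length S = m + 1"

definition chain_link :: "'a::real_vector list \<Rightarrow> nat \<Rightarrow> 'a set" where
  "chain_link S i = closed_segment (S ! i) (S ! (i + 1))"

definition chain_points :: "nat \<Rightarrow> 'a::real_vector list \<Rightarrow> 'a set" where
  "chain_points m S = (\<Union>i<m. chain_link S i)"

definition covering_chain :: "nat \<Rightarrow> 'a::real_vector list \<Rightarrow> 'a set \<Rightarrow> bool" where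
  "covering_chain m S X \<longleftrightarrow> polygonal_chain m S \<and> X \<subseteq> chain_points m S"

definition covering_path :: "nat \<Rightarrow> 'a::real_vector list \<Rightarrow> 'a set \<Rightarrow> bool" where
  "covering_path m S X \<longleftrightarrow> covering_chain m S X \<and>
     (\<forall>x\<in>X. \<forall>i<m. \<forall>j<m. x \<in> chain_link S i \<and> x \<in> chain_link S j \<longrightarrow> i = j)"

definition covering_cycle :: "nat \<Rightarrow> 'a::real_vector list \<Rightarrow> 'a set \<Rightarrow> bool" where
  "covering_cycle m S X \<longleftrightarrow> covering_path m S X \<and> S ! 0 = S ! m"

definition hypercube_nodes :: "(real ^ 'k) set" where
  "hypercube_nodes = {x. \<forall>i. x $ i \<in> {0, 1}}"

text \<open>The number \<open>h(2,k)\<close>, where \<open>k\<close> is the cardinality of the index type \<open>'k\<close>.\<close>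

definition min_link_length :: "'k::finite itself \<Rightarrow> nat" where
  "min_link_length _ =
     (LEAST m. \<exists>S :: (real ^ 'k) list. covering_chain m S hypercube_nodes)"

end

theory Submission
  imports Defs
begin

text \<open>
  Lower bound. A line carries at most two nodes of the cube, so a chain could be hoped to collect
  two new nodes per link; the bends forbid this. Look at one coordinate at a time: a point that
  lies beyond \<open>B\<close> on the line from node \<open>A\<close> to node \<open>B\<close> has coordinates in
  \<open>{0, 1, t, 1 - t}\<close> for one fixed \<open>t \<ge> 1\<close>, and such points are so rigid that two consecutive links
  with two nodes each share a node (\<open>two_links_share_node\<close>), and two links with two nodes each,
  joined by a link through a further node, also share a node (\<open>three_links_share_node\<close>). Hence two
  consecutive links visit at most three nodes and three consecutive links at most four. Cutting
  the chain into triples of links, with at most two links left over, \<open>2 ^ k \<le> 4 * (m div 3) + 3\<close>,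
  and divisibility by four gives \<open>2 ^ (k - 2) \<le> m div 3\<close>.

  Construction. The bound forces every triple of links to visit exactly four nodes, so a cycle is
  sought whose links visit 2, 1, 1, 2, 1, 1, \<dots> nodes. For \<open>k = 2\<close> a triangle around the square
  does it. For \<open>k \<ge> 3\<close> fix two coordinates \<open>p \<noteq> q\<close>. The links with two nodes are main diagonals,
  prolonged to join opposite corners of the cube \<open>[-1, 2] ^ k\<close>; they take all nodes with
  \<open>x $ p = x $ q\<close>. The far end of one diagonal, above the node \<open>B\<close>, has to be joined to the start of
  the next, above the node \<open>A'\<close>, by two links through nodes \<open>E\<close> and \<open>F\<close>. The two links meet
  beyond \<open>E\<close> and \<open>F\<close> as soon as \<open>F - E = A' - B\<close>, since the enlarged corners then differ by
  three times this vector. If the nodes with \<open>x $ p = x $ q = 0\<close> are enumerated as \<open>g 0, g 1, \<dots>\<close>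
  in any order, with the diagonal through \<open>g j\<close> run away from \<open>g j\<close> for even \<open>j\<close> and towards
  \<open>g j\<close> for odd \<open>j\<close>, then \<open>A' - B\<close> is \<open>\<plusminus>(g (j + 1) - g j)\<close>, so \<open>g j\<close> and \<open>g (j + 1)\<close>, both shifted by the
  unit vector of \<open>p\<close> (for even \<open>j\<close>) or of \<open>q\<close> (for odd \<open>j\<close>), serve as \<open>E\<close> and \<open>F\<close>. The pairs
  starting at even \<open>j\<close>, and likewise those starting at odd \<open>j\<close>, exhaust the enumeration because its
  length is even, so every node with \<open>x $ p \<noteq> x $ q\<close> is visited. With \<open>4 * 2 ^ (k - 2)\<close> visits for
  \<open>2 ^ k\<close> nodes, no node can be visited twice (\<open>covering_cycle_by_counting\<close>).
\<close>

section \<open>Nodes of the hypercube\<close>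

lemma node_coord: "x \<in> hypercube_nodes \<Longrightarrow> x $ i = 0 \<or> x $ i = 1"
  by (auto simp: hypercube_nodes_def)

lemma card_face_nodes:
  fixes I :: "'k::finite set"
  shows "card {x \<in> (hypercube_nodes :: (real ^ 'k) set). \<forall>i\<in>I. x $ i = 0} = 2 ^ card (- I)"
proof -
  have "bij_betw (\<lambda>x. {i. x $ i = 1})
      {x \<in> (hypercube_nodes :: (real ^ 'k) set). \<forall>i\<in>I. x $ i = 0} (Pow (- I))"
  proof (rule bij_betwI[where g = "\<lambda>T. \<chi> i. of_bool (i \<in> T)"])
    show "(\<lambda>x. {i. x $ i = 1}) \<in>
        {x \<in> (hypercube_nodes :: (real ^ 'k) set). \<forall>i\<in>I. x $ i = 0} \<rightarrow> Pow (- I)"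
      by auto
    show "(\<lambda>T. \<chi> i. of_bool (i \<in> T)) \<in> Pow (- I) \<rightarrow>
        {x \<in> (hypercube_nodes :: (real ^ 'k) set). \<forall>i\<in>I. x $ i = 0}"
      by (auto simp: hypercube_nodes_def)
    show "(\<chi> i. of_bool (i \<in> {i. x $ i = 1})) = x"
      if "x \<in> {x \<in> (hypercube_nodes :: (real ^ 'k) set). \<forall>i\<in>I. x $ i = 0}" for x
      using that by (auto simp: vec_eq_iff dest: node_coord)
  qed auto
  then show ?thesis
    by (simp add: bij_betw_same_card card_Pow)
qed

lemma card_nodes: "card (hypercube_nodes :: (real ^ 'k::finite) set) = 2 ^ CARD('k)"
  using card_face_nodes[of "{} :: 'k set"] by simp

lemma finite_nodes [simp]: "finite (hypercube_nodes :: (real ^ 'k::finite) set)"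
  by (rule card_ge_0_finite) (simp add: card_nodes)

section \<open>Nodes on one, two and three consecutive links\<close>

text \<open>
  In a coordinate where \<open>A\<close> and \<open>B\<close> differ, the line is not constant, so a point on it is determined by
  that coordinate; and a node has only two values to choose from.
\<close>

lemma no_three_collinear_nodes:
  fixes A B C :: "real ^ 'k::finite"
  assumes nodes: "A \<in> hypercube_nodes" "B \<in> hypercube_nodes" "C \<in> hypercube_nodes"
    and seg: "A \<in> closed_segment P Q" "B \<in> closed_segment P Q" "C \<in> closed_segment P Q"
    and ne: "A \<noteq> B"
  shows "C = A \<or> C = B"
proof -
  obtain a b c where abc: "A = (1 - a) *\<^sub>R P + a *\<^sub>R Q" "B = (1 - b) *\<^sub>R P + b *\<^sub>R Q"
      "C = (1 - c) *\<^sub>R P + c *\<^sub>R Q"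
    using seg unfolding closed_segment_def by blast
  obtain i where i: "A $ i \<noteq> B $ i"
    using ne by (auto simp: vec_eq_iff)
  have eqs: "A $ i = P $ i + a * (Q $ i - P $ i)" "B $ i = P $ i + b * (Q $ i - P $ i)"
      "C $ i = P $ i + c * (Q $ i - P $ i)"
    by (auto simp: abc algebra_simps)
  have "Q $ i - P $ i \<noteq> 0"
    using i eqs by auto
  moreover have "C $ i = A $ i \<or> C $ i = B $ i"
    using i node_coord[OF nodes(1), of i] node_coord[OF nodes(2), of i] node_coord[OF nodes(3), of i]
    by auto
  ultimately have "c = a \<or> c = b"
    using eqs by auto
  then show ?thesis
    using abc by auto
qed

lemma card_nodes_one_link:
  fixes P Q :: "real ^ 'k::finite"
  shows "card (hypercube_nodes \<inter> closed_segment P Q) \<le> 2"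
proof (rule ccontr)
  assume "\<not> ?thesis"
  then have "3 \<le> card (hypercube_nodes \<inter> closed_segment P Q)" by simp
  then obtain T where T: "T \<subseteq> hypercube_nodes \<inter> closed_segment P Q" "card T = 3"
    by (meson obtain_subset_with_card_n)
  then obtain A B C where "T = {A, B, C}" "A \<noteq> B" "A \<noteq> C" "B \<noteq> C"
    by (auto simp: card_3_iff)
  then show False
    using no_three_collinear_nodes[of A B C P Q] T by auto
qed

text \<open>
  This gives the form in which a link with two nodes is used below: its end lies on the ray from
  one of the nodes through the other, at or beyond the latter.
\<close>

lemma segment_end_beyond:
  fixes P Q :: "'a::real_vector"
  assumes "A \<in> closed_segment P Q" "B \<in> closed_segment P Q" "A \<noteq> B"
  shows "\<exists>t\<ge>1. Q = (1 - t) *\<^sub>R A + t *\<^sub>R B \<or> Q = (1 - t) *\<^sub>R B + t *\<^sub>R A"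
proof -
  have main: "\<exists>t\<ge>1. Q = (1 - t) *\<^sub>R X + t *\<^sub>R Y"
    if X: "X = (1 - x) *\<^sub>R P + x *\<^sub>R Q" and Y: "Y = (1 - y) *\<^sub>R P + y *\<^sub>R Q"
      and xy: "x < y" "y \<le> 1" for X Y and x y :: real
  proof (intro exI conjI)
    let ?t = "(1 - x) / (y - x)"
    show "1 \<le> ?t" using xy by (simp add: field_simps)
    have "(1 - ?t) *\<^sub>R X + ?t *\<^sub>R Y =
        ((1 - ?t) * (1 - x) + ?t * (1 - y)) *\<^sub>R P + ((1 - ?t) * x + ?t * y) *\<^sub>R Q"
      unfolding X Y by (simp add: scaleR_add_left scaleR_add_right)
    moreover have "?t * (y - x) = 1 - x" using xy by simp
    then have "(1 - ?t) * (1 - x) + ?t * (1 - y) = 0" "(1 - ?t) * x + ?t * y = 1"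
      by (simp_all only: algebra_simps)
    ultimately show "Q = (1 - ?t) *\<^sub>R X + ?t *\<^sub>R Y" by simp
  qed
  obtain a where a: "a \<le> 1" "A = (1 - a) *\<^sub>R P + a *\<^sub>R Q"
    using assms(1) unfolding closed_segment_def by blast
  obtain b where b: "b \<le> 1" "B = (1 - b) *\<^sub>R P + b *\<^sub>R Q"
    using assms(2) unfolding closed_segment_def by blast
  have "a \<noteq> b" using a b assms(3) by auto
  then consider "a < b" | "b < a" by linarith
  then show ?thesis
    using main[OF a(2) b(2)] main[OF b(2) a(2)] a b by cases blast+
qed

text \<open>
  If \<open>B\<close> has coordinate 1 and \<open>D\<close> has coordinate 0, the point described on the left has a coordinate
  that is at least 1, the one on the right a coordinate that is at most 0; symmetrically with the
  roles exchanged. So \<open>B\<close> and \<open>D\<close> agree everywhere.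
\<close>

lemma two_links_share_node:
  fixes A B C D :: "real ^ 'k::finite"
  assumes nodes: "A \<in> hypercube_nodes" "B \<in> hypercube_nodes" "C \<in> hypercube_nodes"
      "D \<in> hypercube_nodes"
    and ts: "t \<ge> 1" "s \<ge> 1"
    and Q: "(1 - t) *\<^sub>R A + t *\<^sub>R B = (1 - s) *\<^sub>R C + s *\<^sub>R D"
  shows "B = D"
proof -
  have "B $ i = D $ i" for i
  proof -
    have "(1 - t) * A $ i + t * B $ i = (1 - s) * C $ i + s * D $ i"
      using arg_cong[OF Q, of "\<lambda>v. v $ i"] by simp
    then show ?thesis
      using node_coord[OF nodes(1), of i] node_coord[OF nodes(2), of i]
        node_coord[OF nodes(3), of i] node_coord[OF nodes(4), of i] ts
      by auto
  qed
  then show ?thesis by (simp add: vec_eq_iff)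
qed

text \<open>
  \<open>E\<close> is an affine combination of \<open>A\<close>, \<open>B\<close>, \<open>C\<close>, \<open>D\<close> with coefficients \<open>al \<le> 0\<close>, \<open>be \<ge> 0\<close>, \<open>ga \<le> 0\<close>,
  \<open>de \<ge> 0\<close>. Reflecting the cube so that \<open>E\<close> becomes the origin, the combination says that in every
  coordinate the sum of the coefficients of those nodes that differ from \<open>E\<close> vanishes. As \<open>B \<noteq> E\<close> and
  \<open>D \<noteq> E\<close>, the point \<open>E\<close> is not an end of the link, so \<open>be\<close> outweighs \<open>al\<close> and \<open>de\<close> outweighs \<open>ga\<close>, and only few patterns are possible: where \<open>B\<close> differs
  from \<open>E\<close>, so does \<open>C\<close> but not \<open>D\<close>; where \<open>D\<close> differs, so does \<open>A\<close> but not \<open>B\<close>; elsewhere none of the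
  four differs. What is left open is whether \<open>A\<close> differs in the first case and \<open>C\<close> in the second,
  and the vanishing sums allow only choices that identify two of the nodes.
\<close>

lemma three_links_share_node:
  fixes A B C D E :: "real ^ 'k::finite"
  assumes nodes: "A \<in> hypercube_nodes" "B \<in> hypercube_nodes" "C \<in> hypercube_nodes"
      "D \<in> hypercube_nodes" "E \<in> hypercube_nodes"
    and ts: "t \<ge> 1" "s \<ge> 1"
    and E: "E \<in> closed_segment ((1 - t) *\<^sub>R A + t *\<^sub>R B) ((1 - s) *\<^sub>R C + s *\<^sub>R D)"
    and ne: "B \<noteq> E" "D \<noteq> E"
  shows "A = D \<or> B = C \<or> A = C"
proof -
  obtain l where l: "0 \<le> l" "l \<le> 1"
    and El: "E = (1 - l) *\<^sub>R ((1 - t) *\<^sub>R A + t *\<^sub>R B) + l *\<^sub>R ((1 - s) *\<^sub>R C + s *\<^sub>R D)"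
    using E unfolding closed_segment_def by blast
  define al be ga de where "al = (1 - l) * (1 - t)" and "be = (1 - l) * t"
    and "ga = l * (1 - s)" and "de = l * s"
  define a b c d where "a = (\<lambda>i. A $ i \<noteq> E $ i)" and "b = (\<lambda>i. B $ i \<noteq> E $ i)"
    and "c = (\<lambda>i. C $ i \<noteq> E $ i)" and "d = (\<lambda>i. D $ i \<noteq> E $ i)"
  have sum1: "al + be = 1 - l" "ga + de = l"
    by (simp_all add: al_def be_def ga_def de_def algebra_simps)
  have signs: "al \<le> 0" "0 \<le> be" "ga \<le> 0" "0 \<le> de"
    using l ts by (auto simp: al_def be_def ga_def de_def mult_nonneg_nonpos)
  \<comment> \<open>the sum of the coefficients of the nodes that differ from \<open>E\<close> in a given coordinate\<close>
  have key: "al * of_bool (a i) + be * of_bool (b i) + ga * of_bool (c i) + de * of_bool (d i) = 0"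
    for i
  proof -
    have "E $ i = al * A $ i + be * B $ i + ga * C $ i + de * D $ i"
      by (subst El) (simp add: al_def be_def ga_def de_def algebra_simps)
    then show ?thesis
      using node_coord[OF nodes(1), of i] node_coord[OF nodes(2), of i]
        node_coord[OF nodes(3), of i] node_coord[OF nodes(4), of i] node_coord[OF nodes(5), of i] sum1
      unfolding a_def b_def c_def d_def by (elim disjE) simp_all
  qed
  obtain i0 where i0: "b i0"
    using ne(1) by (auto simp: b_def vec_eq_iff)
  obtain k0 where k0: "d k0"
    using ne(2) by (auto simp: d_def vec_eq_iff)
  have "l \<noteq> 1"
  proof
    assume "l = 1"
    then show False
      using key[of k0] k0 sum1 signs by (cases "c k0") (auto simp: al_def be_def)
  qed
  moreover have "l \<noteq> 0"
  proof
    assume "l = 0"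
    then show False
      using key[of i0] i0 sum1 signs by (cases "a i0") (auto simp: ga_def de_def)
  qed
  ultimately have pos: "al + be > 0" "ga + de > 0"
    using l sum1 by auto
  have bD: "c i \<and> \<not> d i" if "b i" for i
    using key[of i] that pos signs by (cases "a i"; cases "c i"; cases "d i") auto
  have dD: "a i \<and> \<not> b i" if "d i" for i
    using key[of i] that pos signs by (cases "a i"; cases "c i"; cases "b i") auto
  have neg: "al < 0" "ga < 0"
    using key[of i0] key[of k0] i0 k0 bD[OF i0] dD[OF k0] pos signs
    by (cases "a i0"; cases "c k0"; force)+
  have none: "\<not> a i \<and> \<not> c i" if "\<not> b i" "\<not> d i" for i
    using key[of i] that neg by (cases "a i"; cases "c i") auto
  \<comment> \<open>Case 1 forces \<open>A\<close> and \<open>D\<close> to have the same pattern, case 2 does so for \<open>B\<close> and \<open>C\<close>, and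
      case 3 for \<open>A\<close> and \<open>C\<close>.\<close>
  consider (1) i where "b i" "\<not> a i" | (2) k where "\<And>i. b i \<Longrightarrow> a i" "d k" "\<not> c k"
    | (3) "\<And>i. b i \<Longrightarrow> a i" "\<And>i. d i \<Longrightarrow> c i"
    by blast
  then have "(\<forall>i. a i = d i) \<or> (\<forall>i. b i = c i) \<or> (\<forall>i. a i = c i)"
  proof cases
    case 1
    then have e: "be + ga = 0" using key[of i] bD[of i] by auto
    have "a j = d j" for j
      using key[of j] e bD[of j] dD[of j] none[of j] neg by (cases "b j"; cases "d j") auto
    then show ?thesis by blast
  next
    case 2
    then have e: "al + de = 0" using key[of k] dD[of k] by auto
    have "b j = c j" for j
      using key[of j] e bD[of j] dD[of j] none[of j] neg by (cases "b j"; cases "d j") auto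
    then show ?thesis by blast
  next
    case 3
    then show ?thesis using bD dD none by blast
  qed
  moreover have "X $ i = Y $ i" if "(X $ i \<noteq> E $ i) = (Y $ i \<noteq> E $ i)"
    "X \<in> hypercube_nodes" "Y \<in> hypercube_nodes" for X Y i
    using that node_coord[of X i] node_coord[of Y i] node_coord[OF nodes(5), of i] by auto
  ultimately show ?thesis
    using nodes unfolding a_def b_def c_def d_def vec_eq_iff by blast
qed

lemma two_node_linkE:
  fixes P Q :: "real ^ 'k::finite"
  assumes "card (hypercube_nodes \<inter> closed_segment P Q) = 2"
  obtains A B t where "hypercube_nodes \<inter> closed_segment P Q = {A, B}" "A \<noteq> B" "t \<ge> 1"
    "Q = (1 - t) *\<^sub>R A + t *\<^sub>R B"
proof -
  obtain A B where AB: "hypercube_nodes \<inter> closed_segment P Q = {A, B}" "A \<noteq> B"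
    using assms by (auto simp: card_2_iff)
  then have "A \<in> closed_segment P Q" "B \<in> closed_segment P Q" by auto
  from segment_end_beyond[OF this AB(2)] show thesis
    using that[OF AB] that[of B A] AB by (metis insert_commute)
qed

lemma card_nodes_two_links:
  fixes P Q R :: "real ^ 'k::finite"
  shows "card (hypercube_nodes \<inter> closed_segment P Q \<union> hypercube_nodes \<inter> closed_segment Q R) \<le> 3"
    (is "card (?M \<union> ?N) \<le> 3")
proof (rule ccontr)
  assume *: "\<not> ?thesis"
  have le: "card ?M \<le> 2" "card ?N \<le> 2"
    by (rule card_nodes_one_link)+
  have un: "card (?M \<union> ?N) + card (?M \<inter> ?N) = card ?M + card ?N"
    using card_Un_Int[of ?M ?N] by simp
  have cards: "card ?M = 2" "card ?N = 2" "card (?M \<inter> ?N) = 0"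
    using * le un by linarith+
  then have disj: "?M \<inter> ?N = {}" by simp
  obtain A B t where AB: "?M = {A, B}" "t \<ge> 1" "Q = (1 - t) *\<^sub>R A + t *\<^sub>R B"
    using cards(1) by (rule two_node_linkE)
  have "card (hypercube_nodes \<inter> closed_segment R Q) = 2"
    using cards(2) by (simp add: closed_segment_commute)
  then obtain C D s where CD: "hypercube_nodes \<inter> closed_segment R Q = {C, D}" "s \<ge> 1"
      "Q = (1 - s) *\<^sub>R C + s *\<^sub>R D"
    by (rule two_node_linkE)
  have CD': "?N = {C, D}" using CD(1) by (simp add: closed_segment_commute)
  have "A \<in> ?M" "B \<in> ?M" "C \<in> ?N" "D \<in> ?N" using AB(1) CD' by simp_all
  then have "B = D"
    using two_links_share_node[of A B C D t s] AB(2,3) CD(2,3) by simp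
  then show False using disj AB(1) CD' by auto
qed

text \<open>
  Five nodes are possible only if the outer links have two nodes each, all four distinct, and
  the middle link adds a fifth, because neither outer link can add more than two nodes to the at
  most three of the other two links.
\<close>

lemma card_nodes_three_links:
  fixes P Q R T :: "real ^ 'k::finite"
  shows "card (hypercube_nodes \<inter> closed_segment P Q \<union> hypercube_nodes \<inter> closed_segment Q R
      \<union> hypercube_nodes \<inter> closed_segment R T) \<le> 4"
    (is "card (?L \<union> ?M \<union> ?N) \<le> 4")
proof (rule ccontr)
  assume *: "\<not> ?thesis"
  have le: "card ?L \<le> 2" "card ?N \<le> 2" "card (?L \<union> ?M) \<le> 3" "card (?M \<union> ?N) \<le> 3"
    by (rule card_nodes_one_link card_nodes_two_links)+
  have "card (?L \<union> ?M \<union> ?N) \<le> card (?L \<union> ?M) + card ?N"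
    by (rule card_Un_le)
  moreover have "card (?L \<union> ?M \<union> ?N) \<le> card ?L + card (?M \<union> ?N)"
    unfolding Un_assoc by (rule card_Un_le)
  ultimately have cards: "card ?L = 2" "card ?N = 2"
    using * le by linarith+
  have "card (?L \<union> ?N) \<le> 4"
    using card_Un_le[of ?L ?N] cards by simp
  moreover have "?L \<union> ?M \<union> ?N = ?L \<union> ?N" if "?M \<subseteq> ?L \<union> ?N"
    using that by blast
  ultimately have "\<not> ?M \<subseteq> ?L \<union> ?N"
    using * by metis
  then obtain E where E: "E \<in> ?M" "E \<notin> ?L" "E \<notin> ?N" by blast
  have disj: "?L \<inter> ?N = {}"
  proof (rule ccontr)
    assume "?L \<inter> ?N \<noteq> {}"
    then obtain x where x: "x \<in> ?L" "x \<in> ?N" by blast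
    then have "?L \<union> ?M \<union> ?N = (?L \<union> ?M) \<union> (?N - {x})" by blast
    then have "card (?L \<union> ?M \<union> ?N) \<le> card (?L \<union> ?M) + card (?N - {x})"
      by (metis card_Un_le)
    moreover have "card (?N - {x}) = 1" using x(2) cards(2) by (subst card_Diff_singleton) simp_all
    ultimately show False using * le by linarith
  qed
  obtain A B t where AB: "?L = {A, B}" "t \<ge> 1" "Q = (1 - t) *\<^sub>R A + t *\<^sub>R B"
    using cards(1) by (rule two_node_linkE)
  have "card (hypercube_nodes \<inter> closed_segment T R) = 2"
    using cards(2) by (simp add: closed_segment_commute)
  then obtain C D s where CD: "hypercube_nodes \<inter> closed_segment T R = {C, D}" "s \<ge> 1"
      "R = (1 - s) *\<^sub>R C + s *\<^sub>R D"
    by (rule two_node_linkE)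
  have CD': "?N = {C, D}" using CD(1) by (simp add: closed_segment_commute)
  have mem: "A \<in> ?L" "B \<in> ?L" "C \<in> ?N" "D \<in> ?N" using AB(1) CD' by simp_all
  then have "A = D \<or> B = C \<or> A = C"
    using three_links_share_node[of A B C D E t s] AB(2,3) CD(2,3) E by blast
  then show False using disj mem by blast
qed

section \<open>The lower bound\<close>

lemma card_nodes_triples:
  fixes S :: "(real ^ 'k::finite) list"
  shows "card (hypercube_nodes \<inter> (\<Union>i<3 * q. chain_link S i)) \<le> 4 * q"
proof (induction q)
  case (Suc q)
  have "{..<3 * Suc q} = insert (3 * q + 2) (insert (3 * q + 1) (insert (3 * q) {..<3 * q}))"
    by auto
  then have "hypercube_nodes \<inter> (\<Union>i<3 * Suc q. chain_link S i) =
      hypercube_nodes \<inter> (\<Union>i<3 * q. chain_link S i) \<union>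
      (hypercube_nodes \<inter> chain_link S (3 * q) \<union> hypercube_nodes \<inter> chain_link S (3 * q + 1)
       \<union> hypercube_nodes \<inter> chain_link S (3 * q + 2))" (is "_ = ?U \<union> ?V")
    by auto
  moreover have "card ?V \<le> 4"
    using card_nodes_three_links[of "S ! (3 * q)" "S ! (3 * q + 1)" "S ! (3 * q + 2)" "S ! (3 * q + 3)"]
    by (simp add: chain_link_def numeral_eq_Suc)
  ultimately show ?case
    using card_Un_le[of ?U ?V] Suc by simp
qed simp

lemma card_nodes_chain:
  fixes S :: "(real ^ 'k::finite) list"
  shows "card (hypercube_nodes \<inter> chain_points m S) \<le> 4 * (m div 3) + 3"
proof -
  define q where "q = m div 3"
  let ?V = "hypercube_nodes \<inter> chain_link S (3 * q) \<union> hypercube_nodes \<inter> chain_link S (3 * q + 1)"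
  let ?U = "hypercube_nodes \<inter> (\<Union>i<3 * q. chain_link S i)"
  have "i < 3 * q \<or> i = 3 * q \<or> i = 3 * q + 1" if "i < m" for i
    using that unfolding q_def by linarith
  then have "hypercube_nodes \<inter> chain_points m S \<subseteq> ?U \<union> ?V"
    unfolding chain_points_def by blast
  then have "card (hypercube_nodes \<inter> chain_points m S) \<le> card (?U \<union> ?V)"
    by (intro card_mono) auto
  also have "\<dots> \<le> card ?U + card ?V" by (rule card_Un_le)
  also have "card ?V \<le> 3"
    using card_nodes_two_links[of "S ! (3 * q)" "S ! (3 * q + 1)" "S ! (3 * q + 2)"]
    by (simp add: chain_link_def)
  finally show ?thesis
    using card_nodes_triples[of S q] unfolding q_def by linarith
qed

lemma two_power_split: "2 \<le> k \<Longrightarrow> (2::nat) ^ k = 4 * 2 ^ (k - 2)"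
  using power_add[of "2::nat" 2 "k - 2"] by (simp only: le_add_diff_inverse) simp

lemma covering_chain_lower_bound:
  fixes S :: "(real ^ 'k::finite) list"
  assumes "covering_chain m S hypercube_nodes" and "CARD('k) \<ge> 2"
  shows "3 * 2 ^ (CARD('k) - 2) \<le> m"
proof -
  have "hypercube_nodes \<inter> chain_points m S = hypercube_nodes"
    using assms(1) by (auto simp: covering_chain_def)
  then have "2 ^ CARD('k) \<le> 4 * (m div 3) + 3"
    using card_nodes_chain[of m S] card_nodes[where 'k = 'k] by simp
  then have "2 ^ (CARD('k) - 2) \<le> m div 3"
    using two_power_split[OF assms(2)] by linarith
  then show ?thesis by linarith
qed

section \<open>Covering cycles\<close>

text \<open>
  The entry \<open>f j c\<close> is the node visited in slot \<open>c\<close> of the \<open>j\<close>-th triple of links, where slots 0 and 1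
  belong to the first link of the triple. There are as many slots as nodes, so if each node
  occupies a slot then it occupies only one. This replaces a verification, for every pair of
  links, that they have no node in common.
\<close>

lemma covering_cycle_by_counting:
  fixes S :: "(real ^ 'k::finite) list" and f :: "nat \<Rightarrow> nat \<Rightarrow> real ^ 'k"
  assumes len: "length S = 3 * N + 1" and closed: "S ! 0 = S ! (3 * N)"
    and N: "card (hypercube_nodes :: (real ^ 'k) set) = 4 * N"
    and l0: "\<And>j. j < N \<Longrightarrow> hypercube_nodes \<inter> chain_link S (3 * j) = {f j 0, f j 1}"
    and l1: "\<And>j. j < N \<Longrightarrow> hypercube_nodes \<inter> chain_link S (3 * j + 1) = {f j 2}"
    and l2: "\<And>j. j < N \<Longrightarrow> hypercube_nodes \<inter> chain_link S (3 * j + 2) = {f j 3}"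
    and onto: "\<And>x. x \<in> hypercube_nodes \<Longrightarrow> \<exists>j<N. \<exists>c<4. x = f j c"
  shows "covering_cycle (3 * N) S hypercube_nodes"
proof -
  let ?I = "{..<N} \<times> {..<4::nat}"
  let ?f = "\<lambda>(j, c). f j c"
  \<comment> \<open>Truncated subtraction makes \<open>c - 1\<close> send the slots 0, 1, 2, 3 to the links 0, 0, 1, 2 of a triple.\<close>
  have on_link: "f j c \<in> hypercube_nodes \<inter> chain_link S (3 * j + (c - 1))"
    if "j < N" "c < 4" for j c
  proof -
    have "c = 0 \<or> c = 1 \<or> c = 2 \<or> c = 3" using that by auto
    then show ?thesis using l0[of j] l1[of j] l2[of j] that by (elim disjE) auto
  qed
  have "?f ` ?I = hypercube_nodes"
    using on_link onto by (fastforce simp: image_iff)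
  then have "card (?f ` ?I) = card ?I" using N by simp
  then have inj: "inj_on ?f ?I" by (intro eq_card_imp_inj_on) auto
  have slot: "\<exists>j<N. \<exists>c<4. x = f j c \<and> i = 3 * j + (c - 1)"
    if "i < 3 * N" "x \<in> hypercube_nodes" "x \<in> chain_link S i" for i x
  proof -
    let ?j = "i div 3"
    have j: "?j < N" using that by auto
    have "i = 3 * ?j + i mod 3" "i mod 3 < 3" by simp_all
    then consider "i = 3 * ?j" | "i = 3 * ?j + 1" | "i = 3 * ?j + 2" by linarith
    then show ?thesis
    proof cases
      case 1
      then have "x = f ?j 0 \<or> x = f ?j 1" using l0[OF j] that by (metis Int_iff insertE singletonD)
      then show ?thesis
      proof
        assume "x = f ?j 0"
        then show ?thesis using 1 j by (intro exI[of _ ?j] exI[of _ 0] conjI) auto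
      next
        assume "x = f ?j 1"
        then show ?thesis using 1 j by (intro exI[of _ ?j] exI[of _ 1] conjI) auto
      qed
    next
      case 2
      then have "x = f ?j 2" using l1[OF j] that by (metis Int_iff singletonD)
      then show ?thesis using 2 j by (intro exI[of _ ?j] exI[of _ 2] conjI) auto
    next
      case 3
      then have "x = f ?j 3" using l2[OF j] that by (metis Int_iff singletonD)
      then show ?thesis using 3 j by (intro exI[of _ ?j] exI[of _ 3] conjI) auto
    qed
  qed
  have "x \<in> chain_points (3 * N) S" if "x \<in> hypercube_nodes" for x
  proof -
    obtain j c where jc: "j < N" "c < 4" "x = f j c" using onto[OF \<open>x \<in> _\<close>] by blast
    then have "3 * j + (c - 1) < 3 * N" by linarith
    then show ?thesis using on_link[OF jc(1,2)] jc(3) unfolding chain_points_def by blast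
  qed
  moreover have "i = i'" if x: "x \<in> hypercube_nodes" "i < 3 * N" "i' < 3 * N"
      "x \<in> chain_link S i" "x \<in> chain_link S i'" for x i i'
  proof -
    obtain j c where jc: "j < N" "c < 4" "x = f j c" "i = 3 * j + (c - 1)"
      using slot[OF x(2,1,4)] by blast
    obtain j' c' where jc': "j' < N" "c' < 4" "x = f j' c'" "i' = 3 * j' + (c' - 1)"
      using slot[OF x(3,1,5)] by blast
    have "(j, c) = (j', c')" using inj_onD[OF inj, of "(j, c)" "(j', c')"] jc jc' by auto
    then show ?thesis using jc jc' by simp
  qed
  ultimately show ?thesis
    using len closed
    unfolding covering_cycle_def covering_path_def covering_chain_def polygonal_chain_def by blast
qed

subsection \<open>The square\<close>

text \<open>
  The triangle with corners \<open>(-1, 0)\<close>, \<open>(2, 0)\<close> and \<open>(1/2, 3/2)\<close> has the unit square inscribed, with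
  one side on its base and one further corner in the interior of each of its other two sides.
\<close>

lemma covering_cycle_square:
  assumes "CARD('k::finite) = 2"
  shows "\<exists>S :: (real ^ 'k) list. covering_cycle 3 S hypercube_nodes"
proof -
  obtain p q :: 'k where pq: "p \<noteq> q" "UNIV = {p, q}"
    using assms by (auto simp: card_2_iff)
  have all: "(\<forall>i::'k. Z i) \<longleftrightarrow> Z p \<and> Z q" for Z
    using pq(2) by (metis (full_types) UNIV_I insertE singletonD)
  define vv :: "real \<Rightarrow> real \<Rightarrow> real ^ 'k" where "vv a b = (\<chi> i. if i = p then a else b)" for a b
  have vp: "vv a b $ p = a" "vv a b $ q = b" for a b
    using pq by (auto simp: vv_def)
  have eq: "x = y \<longleftrightarrow> x $ p = y $ p \<and> x $ q = y $ q" for x y :: "real ^ 'k"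
    by (simp add: vec_eq_iff all)
  have node: "x \<in> hypercube_nodes \<longleftrightarrow> (x $ p = 0 \<or> x $ p = 1) \<and> (x $ q = 0 \<or> x $ q = 1)"
    for x :: "real ^ 'k"
    by (simp add: hypercube_nodes_def all)
  have seg: "x \<in> closed_segment y z \<longleftrightarrow>
      (\<exists>r\<ge>0. r \<le> 1 \<and> x $ p = (1 - r) * y $ p + r * z $ p \<and> x $ q = (1 - r) * y $ q + r * z $ q)"
    for x y z :: "real ^ 'k"
    by (auto simp: closed_segment_def eq)
  let ?S = "[vv (-1) 0, vv 2 0, vv (1/2) (3/2), vv (-1) 0]"
  let ?f = "\<lambda>(j::nat) c::nat. [vv 0 0, vv 1 0, vv 1 1, vv 0 1] ! c"
  have in0: "x \<in> hypercube_nodes \<inter> closed_segment (vv (-1) 0) (vv 2 0) \<longleftrightarrow> x = vv 0 0 \<or> x = vv 1 0" for x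
  proof
    assume "x = vv 0 0 \<or> x = vv 1 0"
    then show "x \<in> hypercube_nodes \<inter> closed_segment (vv (-1) 0) (vv 2 0)"
    proof
      assume "x = vv 0 0"
      then show ?thesis unfolding Int_iff node seg by (auto simp: vp intro: exI[of _ "1/3"])
    next
      assume "x = vv 1 0"
      then show ?thesis unfolding Int_iff node seg by (auto simp: vp intro: exI[of _ "2/3"])
    qed
  qed (auto simp: node seg vp eq field_simps)
  have in1: "x \<in> hypercube_nodes \<inter> closed_segment (vv 2 0) (vv (1/2) (3/2)) \<longleftrightarrow> x = vv 1 1" for x
  proof
    assume "x = vv 1 1"
    then show "x \<in> hypercube_nodes \<inter> closed_segment (vv 2 0) (vv (1/2) (3/2))"
      unfolding Int_iff node seg by (auto simp: vp intro: exI[of _ "2/3"])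
  qed (auto simp: node seg vp eq field_simps)
  have in2: "x \<in> hypercube_nodes \<inter> closed_segment (vv (1/2) (3/2)) (vv (-1) 0) \<longleftrightarrow> x = vv 0 1" for x
  proof
    assume "x = vv 0 1"
    then show "x \<in> hypercube_nodes \<inter> closed_segment (vv (1/2) (3/2)) (vv (-1) 0)"
      unfolding Int_iff node seg by (auto simp: vp intro: exI[of _ "1/3"])
  qed (auto simp: node seg vp eq field_simps)
  have "covering_cycle (3 * 1) ?S hypercube_nodes"
  proof (rule covering_cycle_by_counting[where f = ?f])
    show "card (hypercube_nodes :: (real ^ 'k) set) = 4 * 1"
      using assms card_nodes[where 'k = 'k] by simp
    show "\<exists>j<1. \<exists>c<4. x = ?f j c" if "x \<in> hypercube_nodes" for x
    proof -
      have "x \<in> set [vv 0 0, vv 1 0, vv 1 1, vv 0 1]"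
        using that by (auto simp: node eq vp)
      then obtain i where "i < length [vv 0 0, vv 1 0, vv 1 1, vv 0 1]"
          "[vv 0 0, vv 1 0, vv 1 1, vv 0 1] ! i = x"
        unfolding in_set_conv_nth by blast
      then show ?thesis by (intro exI[of _ 0] exI[of _ i] conjI) simp_all
    qed
  next
    have links: "chain_link ?S 0 = closed_segment (vv (-1) 0) (vv 2 0)"
      "chain_link ?S 1 = closed_segment (vv 2 0) (vv (1/2) (3/2))"
      "chain_link ?S 2 = closed_segment (vv (1/2) (3/2)) (vv (-1) 0)"
      by (simp_all add: chain_link_def numeral_2_eq_2)
    fix j :: nat assume "j < 1"
    then have j: "j = 0" by simp
    show "hypercube_nodes \<inter> chain_link ?S (3 * j) = {?f j 0, ?f j 1}"
      unfolding j mult_0_right links(1) using in0 by (intro set_eqI) simp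
    show "hypercube_nodes \<inter> chain_link ?S (3 * j + 1) = {?f j 2}"
      unfolding j mult_0_right add_0 links(2) using in1 by (intro set_eqI) simp
    show "hypercube_nodes \<inter> chain_link ?S (3 * j + 2) = {?f j 3}"
      unfolding j mult_0_right add_0 links(3) using in2 by (intro set_eqI) simp
  qed simp_all
  then show ?thesis by auto
qed

subsection \<open>Dimension at least three\<close>

definition antipode :: "real ^ 'k::finite \<Rightarrow> real ^ 'k" where
  "antipode x = (\<chi> i. 1 - x $ i)"

text \<open>
  The dilation by 3 about the centre of the cube. It takes a node to the corner of
  \<open>[-1, 2] ^ k\<close> that lies on the same main diagonal, and the segment between opposite enlarged
  corners is cut by its two nodes into thirds.
\<close>

definition enlarge :: "real ^ 'k::finite \<Rightarrow> real ^ 'k" where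
  "enlarge x = (\<chi> i. 3 * x $ i - 1)"

text \<open>
  The point \<open>X\<close> beyond \<open>E\<close> on the ray from \<open>enlarge B\<close> through \<open>E\<close> with \<open>E\<close> at two thirds of the way. It
  depends only on \<open>E - B\<close>, so the rays for \<open>(B, E)\<close> and \<open>(A', F)\<close> end in the same point whenever
  \<open>E - B = F - A'\<close>.
\<close>

definition apex :: "real ^ 'k::finite \<Rightarrow> real ^ 'k \<Rightarrow> real ^ 'k" where
  "apex B E = (\<chi> i. (3 * (E $ i - B $ i) + 1) / 2)"

lemma antipode_antipode [simp]: "antipode (antipode x) = x"
  by (simp add: antipode_def vec_eq_iff)

lemma antipode_node [simp]: "antipode x \<in> hypercube_nodes \<longleftrightarrow> x \<in> hypercube_nodes"
  by (auto simp: antipode_def hypercube_nodes_def)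

lemma nodes_on_diagonal:
  fixes A :: "real ^ 'k::finite"
  assumes A: "A \<in> hypercube_nodes"
  shows "hypercube_nodes \<inter> closed_segment (enlarge A) (enlarge (antipode A)) = {A, antipode A}"
proof -
  have "A = (1 - 1/3) *\<^sub>R enlarge A + (1/3) *\<^sub>R enlarge (antipode A)"
    "antipode A = (1 - 2/3) *\<^sub>R enlarge A + (2/3) *\<^sub>R enlarge (antipode A)"
    by (simp_all add: vec_eq_iff enlarge_def antipode_def field_simps)
  then have "A \<in> closed_segment (enlarge A) (enlarge (antipode A))"
    "antipode A \<in> closed_segment (enlarge A) (enlarge (antipode A))"
    unfolding in_segment by (intro exI[of _ "1/3"] exI[of _ "2/3"] conjI; simp)+
  moreover have "A \<noteq> antipode A"
  proof
    assume "A = antipode A"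
    then have "A $ undefined = 1 - A $ undefined"
      by (metis antipode_def vec_lambda_beta)
    then show False using node_coord[OF A, of undefined] by auto
  qed
  ultimately show ?thesis
    using no_three_collinear_nodes[of A "antipode A"] A by auto
qed

text \<open>
  In a coordinate where \<open>E\<close> and \<open>B\<close> agree, the link runs from \<open>-1\<close> up to \<open>1/2\<close> or from \<open>2\<close> down to
  \<open>1/2\<close>, and takes a value in \<open>{0, 1}\<close> only once. Some agreement is needed: if \<open>E\<close> were the
  antipode of \<open>B\<close>, the link would follow the main diagonal and meet both nodes on it.
\<close>

lemma nodes_on_apex_link:
  fixes B E :: "real ^ 'k::finite"
  assumes B: "B \<in> hypercube_nodes" and E: "E \<in> hypercube_nodes" and p: "E $ p = B $ p"
  shows "hypercube_nodes \<inter> closed_segment (enlarge B) (apex B E) = {E}"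
proof -
  have E2: "E = (1 - 2/3) *\<^sub>R enlarge B + (2/3) *\<^sub>R apex B E"
    by (simp add: vec_eq_iff enlarge_def apex_def field_simps)
  then have "E \<in> closed_segment (enlarge B) (apex B E)"
    unfolding in_segment by (intro exI[of _ "2/3"] conjI) simp_all
  moreover have "x = E" if x: "x \<in> hypercube_nodes" "x \<in> closed_segment (enlarge B) (apex B E)" for x
  proof -
    obtain r where r: "0 \<le> r" "r \<le> 1" "x = (1 - r) *\<^sub>R enlarge B + r *\<^sub>R apex B E"
      using x(2) unfolding closed_segment_def by blast
    have "x $ p = (1 - r) * (3 * B $ p - 1) + r / 2"
      unfolding r(3) using p by (simp add: enlarge_def apex_def)
    then have "r = 2/3"
      using node_coord[OF x(1), of p] node_coord[OF B, of p] r(1,2)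
      by (elim disjE) (auto simp: field_simps)
    then show ?thesis unfolding r(3) by (simp only: E2[symmetric])
  qed
  ultimately show ?thesis using E by auto
qed

text \<open>
  The nodes are grouped by their coordinates at \<open>p\<close> and \<open>q\<close>: \<open>(0, 0)\<close> and \<open>(1, 1)\<close> lie on the diagonals,
  \<open>(1, 0)\<close> on the links that follow a diagonal of even index, \<open>(0, 1)\<close> on those that follow one of
  odd index. The dimension has to be at least three for the number \<open>2 ^ (k - 2)\<close> of diagonals to be
  even, without which the alternation would not close up.
\<close>

lemma covering_cycle_cube:
  assumes k: "CARD('k::finite) \<ge> 3"
  shows "\<exists>S :: (real ^ 'k) list. covering_cycle (3 * 2 ^ (CARD('k) - 2)) S hypercube_nodes"
proof -
  obtain p q :: 'k where pq: "p \<noteq> q"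
  proof -
    obtain T :: "'k set" where "card T = 2" using k obtain_subset_with_card_n[of 2 "UNIV :: 'k set"] by auto
    then show ?thesis using that by (auto simp: card_2_iff)
  qed
  define N :: nat where "N = 2 ^ (CARD('k) - 2)"
  define Z where "Z = {x \<in> (hypercube_nodes :: (real ^ 'k) set). \<forall>i\<in>{p, q}. x $ i = 0}"
  have "card (- {p, q}) = CARD('k) - 2" using pq by (simp add: Compl_eq_Diff_UNIV card_Diff_subset)
  then have cZ: "card Z = N" unfolding Z_def N_def by (subst card_face_nodes) simp
  have "N = 2 * 2 ^ (CARD('k) - 3)"
    using k unfolding N_def by (simp flip: power_Suc)
  then have evN: "even N" and N0: "N > 0" by simp_all
  have cN: "card (hypercube_nodes :: (real ^ 'k) set) = 4 * N"
    using k unfolding N_def card_nodes by (intro two_power_split) simp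
  have "finite Z" unfolding Z_def by simp
  then obtain h where h: "bij_betw h {0..<N} Z"
    using ex_bij_betw_nat_finite[of Z] cZ by auto
  define g where "g j = h (j mod N)" for j
  have gZ: "g j \<in> Z" for j
    using h N0 unfolding g_def bij_betw_def by auto
  have gN: "g N = g 0" by (simp add: g_def)
  have gsurj: "\<exists>j<N. g j = z" if "z \<in> Z" for z
    using h that unfolding g_def bij_betw_def by (force simp: image_iff)
  have g0: "g j $ p = 0" "g j $ q = 0" "g j \<in> hypercube_nodes" for j
    using gZ[of j] by (auto simp: Z_def)
  have up: "z + axis r 1 \<in> hypercube_nodes" if "z \<in> hypercube_nodes" "z $ r = 0" for z :: "real ^ 'k" and r
    using that by (auto simp: hypercube_nodes_def axis_def)
  \<comment> \<open>The \<open>j\<close>-th diagonal runs from above \<open>A j\<close> to above its antipode; the links through \<open>E j\<close> and \<open>F j\<close>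
      lead on to the next diagonal. Alternating the direction makes the antipode of \<open>A j\<close> and
      \<open>A (Suc j)\<close> agree at \<open>p\<close> and at \<open>q\<close>.\<close>
  define A where "A j = (if even j then g j else antipode (g j))" for j
  define E where "E j = (if even j then g (Suc j) + axis p 1 else g j + axis q 1)" for j
  define F where "F j = (if even j then g j + axis p 1 else g (Suc j) + axis q 1)" for j
  have nodes: "A j \<in> hypercube_nodes" "E j \<in> hypercube_nodes" "F j \<in> hypercube_nodes" for j
    using g0 up by (auto simp: A_def E_def F_def)
  have agree: "E j $ p = antipode (A j) $ p" "F j $ p = A (Suc j) $ p" for j
    using g0 pq by (auto simp: A_def E_def F_def antipode_def axis_def)
  have apex_eq: "apex (antipode (A j)) (E j) = apex (A (Suc j)) (F j)" for j
    by (auto simp: vec_eq_iff apex_def A_def E_def F_def antipode_def)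
  define v where "v i = (let j = i div 3 in if i mod 3 = 0 then enlarge (A j)
      else if i mod 3 = 1 then enlarge (antipode (A j)) else apex (antipode (A j)) (E j))" for i
  define S where "S = map v [0..<3 * N + 1]"
  have Sv: "S ! i = v i" if "i \<le> 3 * N" for i
    using that unfolding S_def by (simp del: upt_Suc)
  have v3: "v (3 * j) = enlarge (A j)" "v (3 * j + 1) = enlarge (antipode (A j))"
    "v (3 * j + 2) = apex (antipode (A j)) (E j)" "v (3 * j + 3) = enlarge (A (Suc j))" for j
  proof -
    have "(3 * j + 1) div 3 = j" "(3 * j + 1) mod 3 = 1" "(3 * j + 2) div 3 = j"
      "(3 * j + 2) mod 3 = 2" "(3 * j + 3) div 3 = Suc j" "(3 * j + 3) mod 3 = 0"
      by presburger+
    then show "v (3 * j) = enlarge (A j)" "v (3 * j + 1) = enlarge (antipode (A j))"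
      "v (3 * j + 2) = apex (antipode (A j)) (E j)" "v (3 * j + 3) = enlarge (A (Suc j))"
      unfolding v_def Let_def by simp_all
  qed
  define f where "f j c = [A j, antipode (A j), E j, F j] ! c" for j and c :: nat
  have f: "f j 0 = A j" "f j 1 = antipode (A j)" "f j 2 = E j" "f j 3 = F j" for j
    by (simp_all add: f_def numeral_eq_Suc)
  have "covering_cycle (3 * N) S hypercube_nodes"
  proof (rule covering_cycle_by_counting[where f = f])
    show "length S = 3 * N + 1" by (simp add: S_def)
    have "A N = A 0" using evN gN by (simp add: A_def)
    then show "S ! 0 = S ! (3 * N)" using Sv v3(1)[of 0] v3(1)[of N] by simp
    show "card (hypercube_nodes :: (real ^ 'k) set) = 4 * N" by (rule cN)
  next
    fix j assume j: "j < N"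
    then have le: "3 * j \<le> 3 * N" "3 * j + 1 \<le> 3 * N" "3 * j + 2 \<le> 3 * N" "3 * j + 3 \<le> 3 * N"
      by linarith+
    note Sj = Sv[OF le(1)] Sv[OF le(2)] Sv[OF le(3)] Sv[OF le(4)]
    show "hypercube_nodes \<inter> chain_link S (3 * j) = {f j 0, f j 1}"
      using nodes_on_diagonal[OF nodes(1)[of j]] unfolding chain_link_def Sj v3 f .
    have "chain_link S (3 * j + 1) = closed_segment (S ! (3 * j + 1)) (S ! (3 * j + 2))"
      by (simp add: chain_link_def)
    then show "hypercube_nodes \<inter> chain_link S (3 * j + 1) = {f j 2}"
      using nodes_on_apex_link[of "antipode (A j)" "E j" p] nodes agree(1)
      unfolding Sj v3 f by simp
    have "chain_link S (3 * j + 2) = closed_segment (S ! (3 * j + 3)) (S ! (3 * j + 2))"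
      by (simp add: chain_link_def closed_segment_commute numeral_eq_Suc)
    then show "hypercube_nodes \<inter> chain_link S (3 * j + 2) = {f j 3}"
      using nodes_on_apex_link[of "A (Suc j)" "F j" p] nodes agree(2)
      unfolding Sj v3 f apex_eq by simp
  next
    fix x :: "real ^ 'k" assume x: "x \<in> hypercube_nodes"
    have fI: "\<exists>j<N. \<exists>c<4. x = f j c"
      if "j < N" "x = A j \<or> x = antipode (A j) \<or> x = E j \<or> x = F j" for j
    proof -
      have "\<exists>c<4. x = f j c"
        using that(2)
      proof (elim disjE)
        show "\<exists>c<4. x = f j c" if "x = A j"
          using that by (intro exI[of _ 0]) (simp add: f_def)
        show "\<exists>c<4. x = f j c" if "x = antipode (A j)"
          using that by (intro exI[of _ 1]) (simp add: f_def)
        show "\<exists>c<4. x = f j c" if "x = E j"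
          using that by (intro exI[of _ 2]) (simp add: f_def)
        show "\<exists>c<4. x = f j c" if "x = F j"
          using that by (intro exI[of _ 3]) (simp add: f_def)
      qed
      then show ?thesis using that(1) by blast
    qed
    have down: "x - axis r 1 \<in> hypercube_nodes" if "x $ r = 1" for r
      using x that by (auto simp: hypercube_nodes_def axis_def)
    consider "x $ p = 0" "x $ q = 0" | "x $ p = 1" "x $ q = 1" | "x $ p = 1" "x $ q = 0"
      | "x $ p = 0" "x $ q = 1"
      using node_coord[OF x, of p] node_coord[OF x, of q] by blast
    then show "\<exists>j<N. \<exists>c<4. x = f j c"
    proof cases
      case 1
      then have "x \<in> Z" using x by (simp add: Z_def)
      then obtain j where "j < N" "g j = x" using gsurj by blast
      then show ?thesis by (intro fI[of j]) (auto simp: A_def)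
    next
      case 2
      then have "antipode x \<in> Z" using x by (simp add: Z_def) (simp add: antipode_def)
      then obtain j where j: "j < N" "g j = antipode x" using gsurj by blast
      then have "x = antipode (g j)" by simp
      then show ?thesis using j(1) by (intro fI[of j]) (auto simp: A_def)
    next
      case 3
      then have "x - axis p 1 \<in> Z" using down[of p] pq by (simp add: Z_def) (simp add: axis_def)
      then obtain j where j: "j < N" "g j = x - axis p 1" using gsurj by blast
      then have xj: "x = g j + axis p 1" by simp
      show ?thesis
      proof (cases "even j")
        case True
        then show ?thesis using j(1) xj by (intro fI[of j]) (auto simp: F_def)
      next
        case False
        then obtain i where "j = Suc i" "even i" by (cases j) auto
        then show ?thesis using j(1) xj by (intro fI[of i]) (auto simp: E_def)
      qed
    next
      case 4
      then have "x - axis q 1 \<in> Z" using down[of q] pq by (simp add: Z_def) (simp add: axis_def)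
      then obtain j where j: "j < N" "g j = x - axis q 1" using gsurj by blast
      then have xj: "x = g j + axis q 1" by simp
      show ?thesis
      proof (cases "odd j")
        case True
        then show ?thesis using j(1) xj by (intro fI[of j]) (auto simp: E_def)
      next
        case False
        obtain i where i: "i < N" "odd i" "g (Suc i) = g j"
        proof (cases j)
          case 0
          have "Suc (N - 1) = N" "odd (N - 1)" using evN N0 by auto
          then show ?thesis using that[of "N - 1"] N0 gN 0 by simp
        next
          case (Suc i)
          then show ?thesis using that[of i] j(1) False by auto
        qed
        then show ?thesis using xj by (intro fI[of i]) (auto simp: F_def)
      qed
    qed
  qed
  then show ?thesis unfolding N_def by blast
qed

theorem theorem2p3:
  fixes k :: nat
  assumes "CARD('k::finite) = k" and "k \<ge> 2"
  shows "min_link_length TYPE('k) = 3 * 2 ^ (k - 2) \<and>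
    (\<exists>S :: (real ^ 'k) list.
      covering_cycle (min_link_length TYPE('k)) S hypercube_nodes)"
proof -
  have "\<exists>S :: (real ^ 'k) list. covering_cycle (3 * 2 ^ (k - 2)) S hypercube_nodes"
  proof (cases "k = 2")
    case True
    then show ?thesis using covering_cycle_square[where 'k = 'k] assms by simp
  next
    case False
    then show ?thesis using covering_cycle_cube[where 'k = 'k] assms by simp
  qed
  then obtain S :: "(real ^ 'k) list" where S: "covering_cycle (3 * 2 ^ (k - 2)) S hypercube_nodes"
    by blast
  then have "covering_chain (3 * 2 ^ (k - 2)) S hypercube_nodes"
    by (simp add: covering_cycle_def covering_path_def)
  then have "min_link_length TYPE('k) = 3 * 2 ^ (k - 2)"
    unfolding min_link_length_def
    using covering_chain_lower_bound[where 'k = 'k] assms by (intro Least_equality) blast+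
  then show ?thesis using S by auto
qed

end
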